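(* The monoid $S_\infty/{\sim}=T_\infty/{\sim}=X_\infty/{\sim}$ (the three quotient monoids being identified via the canonical isomorphisms $X_\infty\cong S_\infty\cong T_\infty$) is free.
   Context: Trees. For $n\ge 0$, $T_n$ is the set of linearized labeled binary rooted trees with $n$ interior vertices: finite planar rooted binary trees (every interior vertex has a left and a right child) with leaves labeled $0,1,\dots,n$ from left to right and interior vertices labeled bijectively by $1,\dots,n$ so that the labels decrease along every path from the root to a leaf; $T_0$ consists of the single-vertex tree. $T_\infty=\bigcup_{n\ge0}T_n$. For $r\in T_m$ and $s\in T_n$, the product $r\div s\in T_{m+n}$ (stacking) is obtained by deleting the leaf label $0$ of $s$, increasing all other labels (interior and leaf) of $s$ by $m$, identifying the leaf of $s$ whose label was deleted with the root of $r$, and declaring the root of $s$ to be the root of the result. Permutations. $S_\infty=\bigcup_{n\ge0}S_n$ with the product $\div$ (interlacing): for $\rho\in S_m$, $\sigma\in S_n$, $\rho\div\sigma=\theta\in S_{m+n}$ with $\theta(i)=\rho(i)$ for $1\le i\le m$ and $\theta(i)=\sigma(i-m)+m$ for $m+1\le i\le m+n$. Words. $X=\{x_0,x_1,\dots\}$, $X_n=\{x_{i_1}x_{i_2}\cdots x_{i_n}\mid 0\le i_j\le n-j,\ j=1,\dots,n\}$ and $X_\infty=\bigcup_{n\ge0}X_n$, a submonoid of the free monoid $X^*$ under concatenation. Isomorphisms. $\pi:T_n\to S_n$ sends $t$ to the permutation with $\pi(t)(i)$ the label of the interior vertex that is the last common vertex on the paths from the root to leaves $i-1$ and $i$; it is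 a bijection. $x:S_n\to X_n$ sends $\sigma$ to $x_{\mathsf{inv}_1(\sigma)}\cdots x_{\mathsf{inv}_n(\sigma)}$, where $\mathsf{inv}_i(\sigma)=\#\{j\mid 1\le j<\sigma^{-1}(i),\ \sigma(j)>i\}$; it is a bijection. These give monoid isomorphisms $T_\infty\cong S_\infty\cong X_\infty$. The congruence $\sim$. For trees $r,t\in T_\infty$, $r\sim t$ means that $r$ and $t$ become equal after the labels on the interior vertices are deleted; $\sim$ on $S_\infty$ and $X_\infty$ is the relation transported from $T_\infty$ by the bijections $\pi:T_\infty\to S_\infty$ and $x\circ\pi:T_\infty\to X_\infty$, respectively. It is a monoid congruence. *)

theory Defs
  imports "HOL-Algebra.Group" "HOL-Combinatorics.Permutations"
begin

text \<open>The product of two classes is the union of the classes of all products of representatives.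
  This union is again a class, for all choices of the factors, exactly when the equivalence
  relation is a congruence.\<close>

definition quot_monoid :: "('a, 'b) monoid_scheme \<Rightarrow> ('a \<times> 'a) set \<Rightarrow> 'a set monoid" where
  "quot_monoid M R =
     \<lparr>carrier = carrier M // R,
      monoid.mult = (\<lambda>A B. \<Union>a\<in>A. \<Union>b\<in>B. R `` {a \<otimes>\<^bsub>M\<^esub> b}),
      monoid.one = R `` {\<one>\<^bsub>M\<^esub>}\<rparr>"

definition free_monoid :: "'a set \<Rightarrow> 'a list monoid" where
  "free_monoid B = \<lparr>carrier = lists B, monoid.mult = (@), monoid.one = []\<rparr>"

text \<open>Taking the alphabet from the carrier type loses nothing: an isomorphism restricts to an
  injection of the one-letter words into the carrier.\<close>

definition is_free_monoid :: "('a, 'b) monoid_scheme \<Rightarrow> bool" where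
  "is_free_monoid M \<longleftrightarrow> monoid M \<and> (\<exists>B :: 'a set. free_monoid B \<cong> M)"

text \<open>Leaves carry numbers; interior vertices carry labels of type \<open>'a\<close>.\<close>

datatype 'a lbtree = Leaf nat | Node "'a lbtree" 'a "'a lbtree"

fun leaves :: "'a lbtree \<Rightarrow> nat list" where
  "leaves (Leaf i) = [i]"
| "leaves (Node l a r) = leaves l @ leaves r"

fun interior :: "'a lbtree \<Rightarrow> 'a list" where
  "interior (Leaf i) = []"
| "interior (Node l a r) = interior l @ a # interior r"

fun decreasing :: "nat lbtree \<Rightarrow> bool" where
  "decreasing (Leaf i) \<longleftrightarrow> True"
| "decreasing (Node l a r) \<longleftrightarrow>
     (\<forall>b \<in> set (interior l) \<union> set (interior r). b < a) \<and> decreasing l \<and> decreasing r"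

definition Trees :: "nat \<Rightarrow> nat lbtree set" where
  "Trees n = {t. leaves t = [0..<Suc n] \<and>
                 distinct (interior t) \<and> set (interior t) = {1..n} \<and> decreasing t}"

fun graft :: "nat \<Rightarrow> nat lbtree \<Rightarrow> nat lbtree \<Rightarrow> nat lbtree" where
  "graft m r (Leaf i) = (if i = 0 then r else Leaf (i + m))"
| "graft m r (Node l a t) = Node (graft m r l) (a + m) (graft m r t)"

definition stack :: "nat lbtree \<Rightarrow> nat lbtree \<Rightarrow> nat lbtree" where
  "stack r s = graft (length (interior r)) r s"

definition T_monoid :: "nat lbtree monoid" where
  "T_monoid = \<lparr>carrier = (\<Union>n. Trees n), monoid.mult = stack, monoid.one = Leaf 0\<rparr>"

text \<open>A function permuting \<open>{1..n}\<close> (and fixing everything else) also permutes \<open>{1..n + 1}\<close>.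
  The degree \<open>n\<close> is therefore part of an element, which makes the union of the \<open>S\<^sub>n\<close> disjoint.\<close>

definition interlace ::
    "nat \<times> (nat \<Rightarrow> nat) \<Rightarrow> nat \<times> (nat \<Rightarrow> nat) \<Rightarrow> nat \<times> (nat \<Rightarrow> nat)" where
  "interlace = (\<lambda>(m, \<rho>) (n, \<sigma>).
     (m + n, \<lambda>i. if i \<in> {1..m} then \<rho> i
                 else if i \<in> {m + 1..m + n} then \<sigma> (i - m) + m
                 else i))"

definition S_monoid :: "(nat \<times> (nat \<Rightarrow> nat)) monoid" where
  "S_monoid = \<lparr>carrier = {(n, \<sigma>). \<sigma> permutes {1..n}}, monoid.mult = interlace, monoid.one = (0, id)\<rparr>"

text \<open>The letter \<open>x\<^sub>i\<close> is represented by its index \<open>i\<close>; list positions start at \<open>0\<close>.\<close>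

definition Words :: "nat \<Rightarrow> nat list set" where
  "Words n = {w. length w = n \<and> (\<forall>j \<in> {1..n}. w ! (j - 1) \<le> n - j)}"

definition X_monoid :: "nat list monoid" where
  "X_monoid = \<lparr>carrier = (\<Union>n. Words n), monoid.mult = (@), monoid.one = []\<rparr>"

text \<open>Interior vertices on the path from the root to the leaf \<open>k\<close>, in this order.  They are
  represented by their labels, which identify them uniquely in the trees considered.\<close>

fun path_to :: "nat \<Rightarrow> 'a lbtree \<Rightarrow> 'a list" where
  "path_to k (Leaf i) = []"
| "path_to k (Node l a r) = a # (if k \<in> set (leaves l) then path_to k l else path_to k r)"

definition last_common :: "'a lbtree \<Rightarrow> nat \<Rightarrow> nat \<Rightarrow> 'a" where
  "last_common t j k = last (filter (\<lambda>v. v \<in> set (path_to k t)) (path_to j t))"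

definition perm_of_tree :: "nat lbtree \<Rightarrow> nat \<times> (nat \<Rightarrow> nat)" where
  "perm_of_tree t =
     (let n = length (interior t)
      in (n, \<lambda>i. if i \<in> {1..n} then last_common t (i - 1) i else i))"

definition inv_count :: "(nat \<Rightarrow> nat) \<Rightarrow> nat \<Rightarrow> nat" where
  "inv_count \<sigma> i = card {j. 1 \<le> j \<and> j < inv_into UNIV \<sigma> i \<and> \<sigma> j > i}"

definition word_of_perm :: "nat \<times> (nat \<Rightarrow> nat) \<Rightarrow> nat list" where
  "word_of_perm = (\<lambda>(n, \<sigma>). map (inv_count \<sigma>) [1..<Suc n])"

definition T_sim :: "(nat lbtree \<times> nat lbtree) set" where
  "T_sim = {(r, t). r \<in> carrier T_monoid \<and> t \<in> carrier T_monoid \<and>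
                    map_lbtree (\<lambda>_. ()) r = map_lbtree (\<lambda>_. ()) t}"

definition S_sim :: "((nat \<times> (nat \<Rightarrow> nat)) \<times> (nat \<times> (nat \<Rightarrow> nat))) set" where
  "S_sim = map_prod perm_of_tree perm_of_tree ` T_sim"

definition X_sim :: "(nat list \<times> nat list) set" where
  "X_sim = map_prod (word_of_perm \<circ> perm_of_tree) (word_of_perm \<circ> perm_of_tree) ` T_sim"

end

theory Submission
  imports Defs
begin

text \<open>A tree without interior labels is a left spine with one subtree hanging to the right of each
  spine vertex.  Stacking \<open>r \<div> s\<close> puts \<open>r\<close> below the lower end of the spine of \<open>s\<close>, so the list of
  subtrees of \<open>r \<div> s\<close>, read upwards, is that of \<open>r\<close> followed by that of \<open>s\<close>.  The subtrees are
  arbitrary binary trees, and every binary tree has a decreasing labelling, so that all lists occur.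
  Hence \<open>tree_word\<close> is a homomorphism from the trees onto the free monoid over the
  set of all shapes (\<open>tree_word_hom\<close>, \<open>tree_word_surj\<close>).  Its kernel is the
  congruence in question (\<open>T_sim_kernel\<close>), because the shape of a tree fixes its leaf labels.  So
  the quotient is free.

  For permutations and words it remains to see that the two maps are isomorphisms of
  the monoids before the quotient is taken; they then induce isomorphisms of the quotients by the
  transported relations (\<open>image_quot_monoid_iso\<close>).  The permutation of a tree is the list of
  its interior labels from left to right (\<open>perm_of_tree_eq\<close>), and a decreasing tree is recovered
  from this list by splitting it at its maximum, which is the root (\<open>decreasing_tree_unique\<close>,
  \<open>decreasing_tree_exists\<close>).  The inversion counts recover the relative positions of the values
  \<open>n, n - 1, \<dots>, 1\<close> one after the other (\<open>inv_count_determines_order\<close>), so that the map to words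
  is injective; it is onto since both sides have \<open>n!\<close> elements of degree \<open>n\<close>
  (\<open>card_Words\<close>, \<open>image_word_of_perm\<close>).\<close>

section \<open>Quotients and free monoids\<close>

lemma quotient_eq_image: "A // R = (\<lambda>x. R `` {x}) ` A"
  by (auto simp: quotient_def)

lemma image_quot_class:
  assumes "inj_on f A" "R \<subseteq> A \<times> A" "x \<in> A"
  shows "(map_prod f f ` R) `` {f x} = f ` (R `` {x})"
proof -
  have "z = x" if "(z, y) \<in> R" "f z = f x" for z y
    using inj_onD[OF assms(1) that(2)] that(1) assms(2,3) by auto
  then show ?thesis by (force simp: image_iff)
qed

text \<open>Closure of \<open>M\<close> is what makes the product of two classes meaningful here: outside the carrier
  the class of a product would be empty in \<open>M\<close>, while the one of its image in \<open>N\<close> might not be.\<close>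

lemma image_quot_monoid_iso:
  assumes f: "f \<in> iso M N"
    and closed: "\<And>a b. a \<in> carrier M \<Longrightarrow> b \<in> carrier M \<Longrightarrow> a \<otimes>\<^bsub>M\<^esub> b \<in> carrier M"
    and R: "R \<subseteq> carrier M \<times> carrier M"
  shows "image f \<in> iso (quot_monoid M R) (quot_monoid N (map_prod f f ` R))"
proof -
  let ?R' = "map_prod f f ` R"
  have inj: "inj_on f (carrier M)" and im: "f ` carrier M = carrier N"
    and hom: "\<And>a b. a \<in> carrier M \<Longrightarrow> b \<in> carrier M \<Longrightarrow> f (a \<otimes>\<^bsub>M\<^esub> b) = f a \<otimes>\<^bsub>N\<^esub> f b"
    using f by (auto simp: iso_def hom_def bij_betw_def)
  note class_eq = image_quot_class[OF inj R]
  have sub: "A \<subseteq> carrier M" if "A \<in> carrier M // R" for A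
    using that R by (auto simp: quotient_def)
  have "image f ` (carrier M // R) = carrier N // ?R'"
    unfolding quotient_eq_image im[symmetric] image_image by (simp add: class_eq)
  moreover have "inj_on (image f) (carrier M // R)"
    using inj_on_image_eq_iff[OF inj] sub by (auto simp: inj_on_def)
  moreover have "f ` (\<Union>a\<in>A. \<Union>b\<in>B. R `` {a \<otimes>\<^bsub>M\<^esub> b}) =
      (\<Union>a\<in>f ` A. \<Union>b\<in>f ` B. ?R' `` {a \<otimes>\<^bsub>N\<^esub> b})"
    if "A \<in> carrier M // R" "B \<in> carrier M // R" for A B
  proof -
    have "f ` (R `` {a \<otimes>\<^bsub>M\<^esub> b}) = ?R' `` {f a \<otimes>\<^bsub>N\<^esub> f b}" if "a \<in> A" "b \<in> B" for a b
    proof -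
      have "a \<in> carrier M" "b \<in> carrier M"
        using that sub \<open>A \<in> _\<close> \<open>B \<in> _\<close> by blast+
      then show ?thesis by (simp add: class_eq[symmetric] closed hom)
    qed
    then show ?thesis by (simp add: image_UN)
  qed
  ultimately show ?thesis
    by (auto simp: iso_def hom_def bij_betw_def quot_monoid_def)
qed

text \<open>The first isomorphism theorem, in the direction that sends an element of the target to its fibre.\<close>

lemma fibre_quot_monoid_iso:
  assumes closed: "\<And>a b. a \<in> carrier M \<Longrightarrow> b \<in> carrier M \<Longrightarrow> a \<otimes>\<^bsub>M\<^esub> b \<in> carrier M"
    and g: "g \<in> hom M N" "g ` carrier M = carrier N"
    and R: "R = {(x, y). x \<in> carrier M \<and> y \<in> carrier M \<and> g x = g y}"
  shows "(\<lambda>y. {x \<in> carrier M. g x = y}) \<in> iso N (quot_monoid M R)"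
proof -
  let ?F = "\<lambda>y. {x \<in> carrier M. g x = y}"
  have class_eq: "R `` {x} = ?F (g x)" if "x \<in> carrier M" for x
    using that by (auto simp: R)
  have ex: "\<exists>x \<in> carrier M. g x = y" if "y \<in> carrier N" for y
    using that unfolding g(2)[symmetric] by blast
  have "?F ` carrier N = carrier M // R"
    unfolding quotient_eq_image g(2)[symmetric] image_image by (simp add: class_eq)
  moreover have "inj_on ?F (carrier N)"
  proof (rule inj_onI)
    fix y z assume y: "y \<in> carrier N" and eq: "?F y = ?F z"
    obtain x where "x \<in> ?F y" using ex[OF y] by auto
    moreover from this have "x \<in> ?F z" unfolding eq .
    ultimately show "y = z" by simp
  qed
  moreover have "?F (y \<otimes>\<^bsub>N\<^esub> z) = (\<Union>a\<in>?F y. \<Union>b\<in>?F z. R `` {a \<otimes>\<^bsub>M\<^esub> b})"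
    if "y \<in> carrier N" "z \<in> carrier N" for y z
  proof -
    have eq: "R `` {a \<otimes>\<^bsub>M\<^esub> b} = ?F (y \<otimes>\<^bsub>N\<^esub> z)" if "a \<in> ?F y" "b \<in> ?F z" for a b
      using that g(1) closed by (simp add: class_eq hom_mult)
    have "(\<Union>a\<in>?F y. \<Union>b\<in>?F z. R `` {a \<otimes>\<^bsub>M\<^esub> b}) = (\<Union>a\<in>?F y. \<Union>b\<in>?F z. ?F (y \<otimes>\<^bsub>N\<^esub> z))"
      by (intro SUP_cong refl eq)
    moreover have "?F y \<noteq> {}" "?F z \<noteq> {}" using ex that by auto
    ultimately show ?thesis by (simp del: Collect_empty_eq)
  qed
  ultimately show ?thesis
    by (auto simp: iso_def hom_def bij_betw_def quot_monoid_def)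
qed

lemma monoid_free_monoid: "monoid (free_monoid B)"
  by (rule monoidI) (auto simp: free_monoid_def)

lemma map_free_monoid_iso:
  assumes "inj_on f A"
  shows "map f \<in> iso (free_monoid A) (free_monoid (f ` A))"
proof -
  have "inj_on (map f) (lists A)"
    using assms by (intro inj_on_mapI) (auto elim: inj_on_subset)
  then show ?thesis
    by (auto simp: iso_def hom_def bij_betw_def free_monoid_def lists_image)
qed

text \<open>The alphabet may have any type: replacing each letter \<open>b\<close> by the element \<open>\<phi> [b]\<close> gives an
  alphabet inside the carrier type.  An isomorphism respects only
  multiplication by definition; with the condition on the unit, \<open>M\<close> inherits the monoid laws.\<close>

lemma is_free_monoidI:
  fixes B :: "'c set" and M :: "('a, 'b) monoid_scheme"
  assumes \<phi>: "\<phi> \<in> iso (free_monoid B) M" and one: "\<phi> [] = \<one>\<^bsub>M\<^esub>"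
  shows "is_free_monoid M"
proof -
  have inj: "inj_on \<phi> (lists B)" and im: "\<phi> ` lists B = carrier M"
    and hom: "\<phi> \<in> hom (free_monoid B) M"
    using \<phi> by (auto simp: iso_def bij_betw_def free_monoid_def)
  have "monoid (M\<lparr>carrier := \<phi> ` lists B, one := \<phi> []\<rparr>)"
    using monoid.hom_imp_img_monoid[OF monoid_free_monoid hom] by (simp add: free_monoid_def)
  then have "monoid M" by (simp add: im one)
  define e where "e b = \<phi> [b]" for b
  have inj_e: "inj_on e B"
    by (rule inj_onI) (use inj in \<open>force simp: e_def dest: inj_onD\<close>)
  have "map (inv_into B e) \<in> iso (free_monoid (e ` B)) (free_monoid (inv_into B e ` e ` B))"
    by (intro map_free_monoid_iso inj_on_inv_into) simp
  then have "free_monoid (e ` B) \<cong> free_monoid B"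
    using inv_into_image_cancel[OF inj_e] is_isoI by fastforce
  moreover have "free_monoid B \<cong> M" using \<phi> is_isoI by blast
  ultimately have "free_monoid (e ` B) \<cong> M" by (rule iso_trans)
  with \<open>monoid M\<close> show ?thesis unfolding is_free_monoid_def by blast
qed

section \<open>Trees as words of interior labels\<close>

lemma length_leaves: "length (leaves t) = Suc (length (interior t))"
  by (induction t) auto

lemma set_path_to: "set (path_to k t) \<subseteq> set (interior t)"
  by (induction t) auto

text \<open>The last common vertex of two neighbouring leaves is the vertex that separates them in the
  left-to-right reading, and the interior vertices stand exactly in the gaps between the leaves.\<close>

lemma last_common_consecutive:
  assumes "distinct (leaves t)" "distinct (interior t)" "j < length (interior t)"
  shows "last_common t (leaves t ! j) (leaves t ! Suc j) = interior t ! j"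
proof -
  let ?C = "\<lambda>t j k. filter (\<lambda>v. v \<in> set (path_to k t)) (path_to j t)"
  \<comment> \<open>Nonemptiness is carried along so that \<open>last\<close> is unaffected when the root is put in front.\<close>
  have "?C t (leaves t ! j) (leaves t ! Suc j) \<noteq> [] \<and>
        last (?C t (leaves t ! j) (leaves t ! Suc j)) = interior t ! j"
    using assms
  proof (induction t arbitrary: j)
    case (Leaf i)
    then show ?case by simp
  next
    case (Node l a r)
    let ?u = "leaves (Node l a r) ! j" and ?v = "leaves (Node l a r) ! Suc j"
    have a: "a \<notin> set (path_to k l)" "a \<notin> set (path_to k r)" for k
      using Node.prems(2) set_path_to[of k l] set_path_to[of k r] by auto
    have rl: "x \<notin> set (leaves l)" if "x \<in> set (leaves r)" for x
      using Node.prems(1) that by auto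
    consider "j < length (interior l)" | "j = length (interior l)" | "j > length (interior l)"
      by linarith
    then show ?case
    proof cases
      case 1
      then have uv: "?u = leaves l ! j" "?v = leaves l ! Suc j" "?u \<in> set (leaves l)" "?v \<in> set (leaves l)"
        by (auto simp: nth_append length_leaves)
      have "?C (Node l a r) ?u ?v = a # ?C l ?u ?v"
        using uv(3,4) a by (auto intro!: filter_cong)
      with Node.IH(1)[of j] Node.prems 1 show ?thesis
        unfolding uv(1,2) by (auto simp: nth_append)
    next
      case 2
      have u: "?u \<in> set (leaves l)" using 2 by (auto simp: nth_append length_leaves)
      have v: "?v \<in> set (leaves r)" using 2 length_leaves[of r] by (auto simp: nth_append length_leaves)
      have "filter (\<lambda>v. v = a \<or> v \<in> set (path_to ?v r)) (path_to ?u l) = []"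
        using a Node.prems(2) set_path_to[of ?u l] set_path_to[of ?v r]
        by (auto simp: filter_empty_conv)
      then have "?C (Node l a r) ?u ?v = [a]"
        using u rl[OF v] by simp
      with 2 show ?thesis by (simp add: nth_append)
    next
      case 3
      define i where "i = j - Suc (length (interior l))"
      have j: "j = Suc (length (interior l)) + i" using 3 by (simp add: i_def)
      have i: "i < length (interior r)" using Node.prems(3) j by simp
      have uv: "?u = leaves r ! i" "?v = leaves r ! Suc i"
        using j by (auto simp: nth_append length_leaves)
      have uv': "?u \<in> set (leaves r)" "?v \<in> set (leaves r)"
        unfolding uv using i by (auto simp: length_leaves)
      have "?C (Node l a r) ?u ?v = a # ?C r ?u ?v"
        using rl[OF uv'(1)] rl[OF uv'(2)] a by (auto intro!: filter_cong)
      with Node.IH(2)[of i] Node.prems i show ?thesis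
        unfolding uv by (auto simp: nth_append j)
    qed
  qed
  then show ?thesis by (simp add: last_common_def)
qed

text \<open>One-line notation.\<close>

definition perm_of_list :: "nat list \<Rightarrow> nat \<times> (nat \<Rightarrow> nat)" where
  "perm_of_list xs =
     (length xs, \<lambda>i. if i \<in> {1..length xs} then xs ! (i - 1) else i)"

lemma TreesD:
  assumes "t \<in> Trees n"
  shows "leaves t = [0..<Suc n]" "distinct (interior t)" "set (interior t) = {1..n}"
    "decreasing t" "length (interior t) = n"
  using assms distinct_card[of "interior t"] by (auto simp: Trees_def)

lemma perm_of_tree_eq:
  assumes "t \<in> Trees n"
  shows "perm_of_tree t = perm_of_list (interior t)"
proof -
  note t = TreesD[OF assms]
  have "last_common t (i - 1) i = interior t ! (i - 1)" if "i \<in> {1..n}" for i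
  proof -
    have "i = Suc (i - 1)" "i - 1 < n" using that by auto
    then obtain j where "i = Suc j" "j < n" by blast
    then show ?thesis
      using last_common_consecutive[of t j] t by (simp del: upt_Suc)
  qed
  then show ?thesis
    by (auto simp: perm_of_tree_def perm_of_list_def t(5))
qed

lemma perm_of_list_inject: "perm_of_list xs = perm_of_list ys \<longleftrightarrow> xs = ys"
proof
  assume eq: "perm_of_list xs = perm_of_list ys"
  then have len: "length xs = length ys" by (simp add: perm_of_list_def)
  have "xs ! i = ys ! i" if "i < length xs" for i
    using fun_cong[of _ _ "Suc i", OF arg_cong[where f = snd, OF eq]] that len
    by (simp add: perm_of_list_def)
  with len show "xs = ys" by (simp add: nth_equalityI)
qed simp

lemma image_perm_of_list:
  "perm_of_list ` {xs. distinct xs \<and> set xs = {1..n}} = {n} \<times> {\<sigma>. \<sigma> permutes {1..n}}"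
proof (intro subset_antisym subsetI)
  fix p assume "p \<in> perm_of_list ` {xs. distinct xs \<and> set xs = {1..n}}"
  then obtain xs where xs: "distinct xs" "set xs = {1..n}" and p: "p = perm_of_list xs" by auto
  have len: "length xs = n" using xs distinct_card[of xs] by simp
  let ?\<sigma> = "\<lambda>i. if i \<in> {1..n} then xs ! (i - 1) else i"
  have "inj_on ?\<sigma> {1..n}"
    using xs(1) len by (auto simp: inj_on_def nth_eq_iff_index_eq)
  moreover have "?\<sigma> ` {1..n} \<subseteq> {1..n}"
    using xs(2) len nth_mem[of "_ - 1" xs] by auto
  ultimately have "bij_betw ?\<sigma> {1..n} {1..n}"
    using endo_inj_surj[of "{1..n}" ?\<sigma>] by (simp add: bij_betw_def)
  then have "?\<sigma> permutes {1..n}"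
    by (rule bij_imp_permutes) auto
  then show "p \<in> {n} \<times> {\<sigma>. \<sigma> permutes {1..n}}"
    using p len by (simp add: perm_of_list_def)
next
  fix p assume "p \<in> {n} \<times> {\<sigma>. \<sigma> permutes {1..n}}"
  then obtain \<sigma> where p: "p = (n, \<sigma>)" and \<sigma>: "\<sigma> permutes {1..n}" by auto
  let ?xs = "map \<sigma> [1..<Suc n]"
  have "distinct ?xs"
    using permutes_inj_on[OF \<sigma>] by (simp add: distinct_map del: upt_Suc)
  moreover have "set ?xs = {1..n}"
    using permutes_image[OF \<sigma>] by (simp add: atLeastLessThanSuc_atLeastAtMost del: upt_Suc)
  moreover have "perm_of_list ?xs = p"
    using permutes_not_in[OF \<sigma>] by (auto simp: perm_of_list_def p fun_eq_iff simp del: upt_Suc)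
  ultimately show "p \<in> perm_of_list ` {xs. distinct xs \<and> set xs = {1..n}}" by blast
qed

text \<open>The root carries the maximal label, and this label, occurring once, tells where the interior
  labels of the left subtree end.\<close>

lemma decreasing_tree_unique:
  assumes "decreasing t" "decreasing t'" "distinct (interior t)"
    and "interior t = interior t'" "leaves t = leaves t'"
  shows "t = t'"
  using assms
proof (induction t arbitrary: t')
  case (Leaf i)
  then show ?case by (cases t') auto
next
  case (Node l a r)
  then obtain l' a' r' where t': "t' = Node l' a' r'" by (cases t') auto
  have eq: "interior l @ a # interior r = interior l' @ a' # interior r'"
    using Node.prems(4) t' by simp
  have "a = Max (set (interior l @ a # interior r))"
    using Node.prems(1) by (intro Max_eqI[symmetric]) (auto intro: less_imp_le)
  also have "\<dots> = a'"
    unfolding eq using Node.prems(2) t' by (intro Max_eqI) (auto intro: less_imp_le)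
  finally have a: "a = a'" .
  have int: "interior l = interior l'" "interior r = interior r'"
  proof -
    have "a \<notin> set (interior l)" "a \<notin> set (interior r)" using Node.prems(3) by auto
    from append_Cons_eq_iff[OF this] eq[folded a]
    show "interior l = interior l'" "interior r = interior r'" by blast+
  qed
  then have "leaves l = leaves l'" "leaves r = leaves r'"
    using Node.prems(5) t' by (auto simp: length_leaves)
  with Node int a t' show ?case by auto
qed

text \<open>Split the list at its maximum and put the maximum at the root.\<close>

lemma decreasing_tree_exists:
  assumes "distinct xs"
  shows "\<exists>t. decreasing t \<and> interior t = xs \<and> leaves t = [k..<Suc (k + length xs)]"
  using assms
proof (induction "length xs" arbitrary: xs k rule: less_induct)
  case less
  show ?case
  proof (cases "xs = []")
    case True
    then show ?thesis by (intro exI[of _ "Leaf k"]) simp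
  next
    case False
    let ?a = "Max (set xs)"
    have "?a \<in> set xs" using False by simp
    then obtain ys zs where xs: "xs = ys @ ?a # zs" by (meson split_list)
    have max: "b \<le> ?a" if "b \<in> set xs" for b using that by simp
    obtain l where l: "decreasing l" "interior l = ys" "leaves l = [k..<Suc (k + length ys)]"
      using less(1)[of ys k] less(2) arg_cong[OF xs, of length] arg_cong[OF xs, of distinct]
      by (auto simp del: upt_Suc)
    obtain r where r: "decreasing r" "interior r = zs"
      "leaves r = [Suc (k + length ys)..<Suc (Suc (k + length ys) + length zs)]"
      using less(1)[of zs "Suc (k + length ys)"] less(2) arg_cong[OF xs, of length]
        arg_cong[OF xs, of distinct]
      by (auto simp del: upt_Suc)
    have "b < ?a" if "b \<in> set ys \<union> set zs" for b
    proof -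
      have "b \<in> set xs" "b \<noteq> ?a"
        using that less(2) arg_cong[OF xs, of distinct] arg_cong[OF xs, of set] by auto
      with max show ?thesis by (metis le_neq_implies_less)
    qed
    moreover have "leaves l @ leaves r = [k..<Suc (k + length xs)]"
      unfolding l r using upt_add_eq_append[of k "Suc (k + length ys)" "Suc (length zs)"]
        arg_cong[OF xs, of length] by (simp add: ac_simps del: upt_Suc)
    ultimately show ?thesis
      using l(1,2) r(1,2) xs by (intro exI[of _ "Node l ?a r"]) auto
  qed
qed

lemma interior_bij_betw_Trees:
  "bij_betw interior (Trees n) {xs. distinct xs \<and> set xs = {1..n}}"
proof (rule bij_betw_imageI)
  show "inj_on interior (Trees n)"
    by (rule inj_onI) (use decreasing_tree_unique TreesD in metis)
  show "interior ` Trees n = {xs. distinct xs \<and> set xs = {1..n}}"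
  proof (intro subset_antisym subsetI)
    fix xs assume "xs \<in> {xs. distinct xs \<and> set xs = {1..n}}"
    then have xs: "distinct xs" "set xs = {1..n}" by auto
    obtain t where t: "decreasing t" "interior t = xs" "leaves t = [0..<Suc (0 + length xs)]"
      using decreasing_tree_exists[OF xs(1)] by blast
    have "length xs = n" using xs distinct_card[of xs] by simp
    then have "t \<in> Trees n" using t xs by (simp add: Trees_def)
    then show "xs \<in> interior ` Trees n" using t by blast
  qed (auto simp: TreesD)
qed

section \<open>Stacking\<close>

lemma map_add_const_upt: "map (\<lambda>i. i + m) [a..<b] = [a + m..<b + m]"
  by (induction b) auto

lemma graft_no_zero:
  assumes "0 \<notin> set (leaves s)"
  shows "leaves (graft m r s) = map (\<lambda>i. i + m) (leaves s)"
    "interior (graft m r s) = map (\<lambda>i. i + m) (interior s)"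
  using assms by (induction s) auto

text \<open>Only the leftmost leaf is replaced, so the reading of \<open>r\<close> comes first and what remains of \<open>s\<close>
  is shifted.\<close>

lemma graft_first_leaf:
  assumes "hd (leaves s) = 0" "0 \<notin> set (tl (leaves s))"
  shows "leaves (graft m r s) = leaves r @ map (\<lambda>i. i + m) (tl (leaves s))"
    "interior (graft m r s) = interior r @ map (\<lambda>i. i + m) (interior s)"
  using assms
proof (induction s)
  case (Node l a t)
  have ne: "leaves l \<noteq> []" using length_leaves[of l] by auto
  {
    case 1
    then show ?case using Node.IH(1) ne graft_no_zero by simp
  next
    case 2
    then show ?case using Node.IH(2) ne graft_no_zero by simp
  }
qed auto

lemma decreasing_graft:
  assumes "decreasing r" "decreasing s" "\<forall>b \<in> set (interior r). b \<le> m" "0 \<notin> set (interior s)"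
  shows "decreasing (graft m r s)"
proof -
  have sub: "set (interior (graft m r s)) \<subseteq> set (interior r) \<union> (\<lambda>i. i + m) ` set (interior s)" for s
    by (induction s) auto
  show ?thesis using assms
  proof (induction s)
    case (Node l a t)
    have "b < a + m" if "b \<in> set (interior (graft m r l)) \<union> set (interior (graft m r t))" for b
      using that sub[of l] sub[of t] Node.prems by fastforce
    with Node show ?case by simp
  qed simp
qed

lemma interior_stack:
  assumes "s \<in> Trees n"
  shows "interior (stack r s) =
    interior r @ map (\<lambda>i. i + length (interior r)) (interior s)"
  using TreesD[OF assms] by (simp add: stack_def graft_first_leaf upt_conv_Cons del: upt_Suc)

lemma stack_Trees:
  assumes r: "r \<in> Trees m" and s: "s \<in> Trees n"
  shows "stack r s \<in> Trees (m + n)"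
proof -
  note r = TreesD[OF r] and s' = TreesD[OF s]
  have int: "interior (stack r s) = interior r @ map (\<lambda>i. i + m) (interior s)"
    using interior_stack[OF s] r(5) by simp
  have "leaves (stack r s) = [0..<Suc m] @ map (\<lambda>i. i + m) [Suc 0..<Suc n]"
    using graft_first_leaf(1)[of s m r] r(1,5) s'(1)
    by (simp add: stack_def upt_conv_Cons del: upt_Suc)
  also have "\<dots> = [0..<Suc (m + n)]"
    using upt_add_eq_append[of 0 "Suc m" n]
    by (simp add: map_add_const_upt ac_simps del: upt_Suc)
  finally have "leaves (stack r s) = [0..<Suc (m + n)]" .
  moreover have "distinct (interior (stack r s))"
    unfolding int using r(2,3) s'(2,3) by (auto simp: distinct_map)
  moreover have "(\<lambda>i. i + m) ` {1..n} = {Suc m..m + n}"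
    by (simp add: image_add_atLeastAtMost' ac_simps)
  then have "set (interior (stack r s)) = {1..m + n}"
    unfolding int using r(3) s'(3) by auto
  moreover have "decreasing (stack r s)"
    unfolding stack_def using r s' by (intro decreasing_graft) auto
  ultimately show ?thesis by (simp add: Trees_def)
qed

lemma T_monoid_closed:
  "a \<in> carrier T_monoid \<Longrightarrow> b \<in> carrier T_monoid \<Longrightarrow> a \<otimes>\<^bsub>T_monoid\<^esub> b \<in> carrier T_monoid"
  using stack_Trees by (fastforce simp: T_monoid_def)

lemma perm_of_tree_stack:
  assumes r: "r \<in> Trees m" and s: "s \<in> Trees n"
  shows "perm_of_tree (stack r s) = interlace (perm_of_tree r) (perm_of_tree s)"
  unfolding perm_of_tree_eq[OF stack_Trees[OF r s]] perm_of_tree_eq[OF r] perm_of_tree_eq[OF s]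
    interior_stack[OF s] perm_of_list_def interlace_def
  by (auto simp: fun_eq_iff nth_append) 

lemma perm_of_tree_iso: "perm_of_tree \<in> iso T_monoid S_monoid"
proof -
  have im: "perm_of_tree ` Trees n = {n} \<times> {\<sigma>. \<sigma> permutes {1..n}}" for n
  proof -
    have "perm_of_tree ` Trees n = perm_of_list ` interior ` Trees n"
      by (simp add: image_image perm_of_tree_eq cong: image_cong)
    then show ?thesis
      using image_perm_of_list interior_bij_betw_Trees by (simp add: bij_betw_def)
  qed
  have "perm_of_tree ` (\<Union>n. Trees n) = {(n, \<sigma>). \<sigma> permutes {1..n}}"
    unfolding image_UN im by auto
  moreover have "inj_on perm_of_tree (\<Union>n. Trees n)"
  proof (rule inj_onI)
    fix s t assume st: "s \<in> (\<Union>n. Trees n)" "t \<in> (\<Union>n. Trees n)" and "perm_of_tree s = perm_of_tree t"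
    then have eq: "interior s = interior t" by (auto simp: perm_of_tree_eq perm_of_list_inject)
    obtain m n where "s \<in> Trees m" "t \<in> Trees n" using st by auto
    with eq show "s = t"
      using interior_bij_betw_Trees[of n] TreesD(5) by (metis bij_betw_imp_inj_on inj_onD)
  qed
  moreover have "perm_of_tree \<in> hom T_monoid S_monoid"
  proof (rule homI)
    fix t assume "t \<in> carrier T_monoid"
    then obtain n where "t \<in> Trees n" by (auto simp: T_monoid_def)
    then have "perm_of_tree t \<in> {n} \<times> {\<sigma>. \<sigma> permutes {1..n}}" unfolding im[symmetric] by simp
    then show "perm_of_tree t \<in> carrier S_monoid" by (auto simp: S_monoid_def)
  qed (auto simp: T_monoid_def S_monoid_def perm_of_tree_stack)
  ultimately show ?thesis
    by (simp add: iso_def bij_betw_def T_monoid_def S_monoid_def)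
qed

section \<open>Permutations as words of inversion counts\<close>

text \<open>The inverse of a permutation in one-line notation; the notation \<open>inv\<close> denotes the inverse in
  a group here.\<close>

abbreviation place :: "(nat \<Rightarrow> nat) \<Rightarrow> nat \<Rightarrow> nat" where
  "place \<sigma> \<equiv> inv_into UNIV \<sigma>"

text \<open>Inversions counted by the larger value instead of by its position.\<close>

lemma inv_count_eq:
  assumes "\<sigma> permutes {1..n}" "i \<in> {1..n}"
  shows "inv_count \<sigma> i = card {a \<in> {i<..n}. place \<sigma> a < place \<sigma> i}"
proof -
  have "bij_betw \<sigma> {j. 1 \<le> j \<and> j < place \<sigma> i \<and> \<sigma> j > i} {a \<in> {i<..n}. place \<sigma> a < place \<sigma> i}"
  proof (rule bij_betw_byWitness[where f' = "place \<sigma>"])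
    have \<sigma>: "\<sigma> j \<in> {1..n} \<longleftrightarrow> j \<in> {1..n}" and \<sigma>': "place \<sigma> j \<in> {1..n} \<longleftrightarrow> j \<in> {1..n}" for j
      using permutes_in_image[OF assms(1)] permutes_in_image[OF permutes_inv[OF assms(1)]] by blast+
    note inv = permutes_inverses[OF assms(1)]
    show "\<sigma> ` {j. 1 \<le> j \<and> j < place \<sigma> i \<and> \<sigma> j > i} \<subseteq> {a \<in> {i<..n}. place \<sigma> a < place \<sigma> i}"
    proof clarify
      fix j assume j: "1 \<le> j" "j < place \<sigma> i" "\<sigma> j > i"
      have "place \<sigma> i \<in> {1..n}" using \<sigma>' assms(2) by blast
      then have "j \<in> {1..n}" using j by auto
      then have "\<sigma> j \<in> {1..n}" using \<sigma> by blast
      then show "\<sigma> j \<in> {i<..n} \<and> place \<sigma> (\<sigma> j) < place \<sigma> i" using j inv by auto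
    qed
    show "place \<sigma> ` {a \<in> {i<..n}. place \<sigma> a < place \<sigma> i} \<subseteq> {j. 1 \<le> j \<and> j < place \<sigma> i \<and> \<sigma> j > i}"
    proof clarify
      fix a assume a: "a \<in> {i<..n}" "place \<sigma> a < place \<sigma> i"
      then have "place \<sigma> a \<in> {1..n}" using \<sigma>'[of a] by auto
      then show "1 \<le> place \<sigma> a \<and> place \<sigma> a < place \<sigma> i \<and> \<sigma> (place \<sigma> a) > i" using a inv by auto
    qed
  qed (use permutes_inverses[OF assms(1)] in auto)
  then show ?thesis unfolding inv_count_def by (rule bij_betw_same_card)
qed

text \<open>Downward induction: suppose that both permutations arrange the values above \<open>i\<close> in the same
  order.  The values above \<open>i\<close> that precede \<open>i\<close> form an initial segment of this common order for
  either permutation, and the inversion count of \<open>i\<close> is the length of this segment.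
  So the two segments agree, and \<open>i\<close> is inserted at the same place.\<close>

lemma inv_count_determines_order:
  assumes \<sigma>: "\<sigma> permutes {1..n}" and \<tau>: "\<tau> permutes {1..n}"
    and eq: "\<And>i. i \<in> {1..n} \<Longrightarrow> inv_count \<sigma> i = inv_count \<tau> i"
    and k: "1 \<le> k" and a: "a \<in> {k..n}" and b: "b \<in> {k..n}"
  shows "place \<sigma> a < place \<sigma> b \<longleftrightarrow> place \<tau> a < place \<tau> b"
proof (cases "k \<le> n")
  case True
  let ?p = "place \<sigma>" and ?q = "place \<tau>"
  have inj: "?p a = ?p b \<longleftrightarrow> a = b" "?q a = ?q b \<longleftrightarrow> a = b" for a b
    using permutes_inj[OF permutes_inv[OF \<sigma>]] permutes_inj[OF permutes_inv[OF \<tau>]]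
    by (auto dest: injD)
  from True k have "\<forall>a \<in> {k..n}. \<forall>b \<in> {k..n}. ?p a < ?p b \<longleftrightarrow> ?q a < ?q b"
  proof (induction rule: inc_induct)
    case base
    then show ?case by auto
  next
    case (step i)
    let ?P = "{a \<in> {i<..n}. ?p a < ?p i}" and ?Q = "{a \<in> {i<..n}. ?q a < ?q i}"
    have IH: "?p a < ?p b \<longleftrightarrow> ?q a < ?q b" if "a \<in> {i<..n}" "b \<in> {i<..n}" for a b
      using step that by auto
    \<comment> \<open>Two initial segments of a linear order are comparable.\<close>
    have "?P \<subseteq> ?Q \<or> ?Q \<subseteq> ?P"
    proof (rule ccontr)
      assume "\<not> ?thesis"
      then obtain a b where ab: "a \<in> {i<..n}" "?p a < ?p i" "\<not> ?q a < ?q i"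
        "b \<in> {i<..n}" "?q b < ?q i" "\<not> ?p b < ?p i" by blast
      then have "?p a < ?p b" "?q b < ?q a" by linarith+
      with IH ab show False by (meson less_asym)
    qed
    moreover have "card ?P = card ?Q"
      using inv_count_eq[OF \<sigma>] inv_count_eq[OF \<tau>] eq step by simp
    ultimately have "?P = ?Q"
      using card_subset_eq[of ?P ?Q] card_subset_eq[of ?Q ?P] by auto
    then have i: "?p a < ?p i \<longleftrightarrow> ?q a < ?q i" if "a \<in> {i<..n}" for a
      using that by blast
    have i': "?p i < ?p a \<longleftrightarrow> ?q i < ?q a" if "a \<in> {i<..n}" for a
      using i[OF that] inj[of a i] that by (metis greaterThanAtMost_iff less_irrefl linorder_neqE_nat less_asym)
    show ?case
    proof (intro ballI)
      fix a b assume "a \<in> {i..n}" "b \<in> {i..n}"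
      then consider "a \<in> {i<..n}" "b \<in> {i<..n}" | "a \<in> {i<..n}" "b = i"
        | "a = i" "b \<in> {i<..n}" | "a = i" "b = i" by force
      then show "?p a < ?p b \<longleftrightarrow> ?q a < ?q b"
        by cases (use IH i i' in auto)
    qed
  qed
  with a b show ?thesis by blast
qed (use a in auto)

text \<open>A permutation is determined by the order in which its values occur.\<close>

lemma permutes_inv_eq_card:
  assumes "\<sigma> permutes {1..n}" "a \<in> {1..n}"
  shows "place \<sigma> a = Suc (card {b \<in> {1..n}. place \<sigma> b < place \<sigma> a})"
proof -
  have p: "place \<sigma> permutes {1..n}" using assms(1) by (rule permutes_inv)
  have a: "place \<sigma> a \<in> {1..n}" using permutes_in_image[OF p] assms(2) by blast
  have "place \<sigma> ` {b \<in> {1..n}. place \<sigma> b < place \<sigma> a} = {1..<place \<sigma> a}"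
  proof (intro subset_antisym subsetI)
    fix c assume c: "c \<in> {1..<place \<sigma> a}"
    then have "c \<in> {1..n}" using a by auto
    then obtain b where "b \<in> {1..n}" "c = place \<sigma> b" using permutes_image[OF p] by blast
    with c show "c \<in> place \<sigma> ` {b \<in> {1..n}. place \<sigma> b < place \<sigma> a}" by auto
  next
    fix c assume "c \<in> place \<sigma> ` {b \<in> {1..n}. place \<sigma> b < place \<sigma> a}"
    then show "c \<in> {1..<place \<sigma> a}" using permutes_in_image[OF p] by fastforce
  qed
  then have "card {b \<in> {1..n}. place \<sigma> b < place \<sigma> a} = card {1..<place \<sigma> a}"
    using card_image[OF permutes_inj_on[OF p]] by metis
  with a show ?thesis by simp
qed

lemma word_of_perm_inj: "inj_on word_of_perm ({n} \<times> {\<sigma>. \<sigma> permutes {1..n}})"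
proof (rule inj_onI)
  fix x y assume x: "x \<in> {n} \<times> {\<sigma>. \<sigma> permutes {1..n}}" and y: "y \<in> {n} \<times> {\<sigma>. \<sigma> permutes {1..n}}"
    and eq: "word_of_perm x = word_of_perm y"
  obtain \<sigma> \<tau> where xy: "x = (n, \<sigma>)" "y = (n, \<tau>)" and \<sigma>: "\<sigma> permutes {1..n}" and \<tau>: "\<tau> permutes {1..n}"
    using x y by auto
  have cnt: "inv_count \<sigma> i = inv_count \<tau> i" if "i \<in> {1..n}" for i
    using eq that by (auto simp: xy word_of_perm_def simp del: upt_Suc)
  note order = inv_count_determines_order[OF \<sigma> \<tau> cnt order.refl]
  have "place \<sigma> a = place \<tau> a" for a
  proof (cases "a \<in> {1..n}")
    case True
    then have "{b \<in> {1..n}. place \<sigma> b < place \<sigma> a} = {b \<in> {1..n}. place \<tau> b < place \<tau> a}"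
      using order by blast
    then show ?thesis
      using permutes_inv_eq_card[OF \<sigma> True] permutes_inv_eq_card[OF \<tau> True] by simp
  next
    case False
    then show ?thesis
      using permutes_not_in[OF permutes_inv[OF \<sigma>]] permutes_not_in[OF permutes_inv[OF \<tau>]] by simp
  qed
  then have "place \<sigma> = place \<tau>" by blast
  then have "\<sigma> = \<tau>" using permutes_inv_inv \<sigma> \<tau> by metis
  then show "x = y" by (simp add: xy)
qed

lemma Words_Suc: "Words (Suc n) = (\<lambda>(a, w). a # w) ` ({..n} \<times> Words n)"
proof (intro subset_antisym subsetI)
  fix w assume w: "w \<in> Words (Suc n)"
  then obtain a v where v: "w = a # v" by (cases w) (auto simp: Words_def)
  have le: "w ! (j - 1) \<le> Suc n - j" if "j \<in> {1..Suc n}" for j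
    using w that by (simp add: Words_def)
  have "a \<le> n" using le[of 1] v by simp
  moreover have "v ! (j - 1) \<le> n - j" if "j \<in> {1..n}" for j
    using le[of "Suc j"] that v by (cases j) auto
  ultimately show "w \<in> (\<lambda>(a, w). a # w) ` ({..n} \<times> Words n)"
    using w v by (auto simp: Words_def)
next
  fix w assume "w \<in> (\<lambda>(a, w). a # w) ` ({..n} \<times> Words n)"
  then obtain a v where w: "w = a # v" and a: "a \<le> n" and v: "v \<in> Words n" by auto
  have "w ! (j - 1) \<le> Suc n - j" if "j \<in> {1..Suc n}" for j
  proof (cases "j = 1")
    case True
    then show ?thesis by (simp add: w a)
  next
    case False
    define i where "i = j - 1"
    have i: "j = Suc i" "i \<in> {1..n}" using False that by (auto simp: i_def)
    have "v ! (i - 1) \<le> n - i" using v i(2) by (auto simp: Words_def)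
    with i show ?thesis by (simp add: w)
  qed
  then show "w \<in> Words (Suc n)" using v by (simp add: Words_def w)
qed

lemma card_Words: "finite (Words n) \<and> card (Words n) = fact n"
proof (induction n)
  case 0
  have "Words 0 = {[]}" by (auto simp: Words_def)
  then show ?case by simp
next
  case (Suc n)
  have "inj_on (\<lambda>(a, w). a # w) ({..n} \<times> Words n)" by (auto simp: inj_on_def)
  with Suc show ?case by (simp add: Words_Suc card_image card_cartesian_product)
qed

lemma image_word_of_perm:
  "word_of_perm ` ({n} \<times> {\<sigma>. \<sigma> permutes {1..n}}) = Words n"
proof (rule card_subset_eq)
  show "word_of_perm ` ({n} \<times> {\<sigma>. \<sigma> permutes {1..n}}) \<subseteq> Words n"
  proof clarify
    fix \<sigma> :: "nat \<Rightarrow> nat" assume \<sigma>: "\<sigma> permutes {1..n}"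
    have "inv_count \<sigma> i \<le> n - i" if "i \<in> {1..n}" for i
    proof -
      have "card {a \<in> {i<..n}. place \<sigma> a < place \<sigma> i} \<le> card {i<..n}" by (intro card_mono) auto
      then show ?thesis by (simp add: inv_count_eq[OF \<sigma> that])
    qed
    then show "word_of_perm (n, \<sigma>) \<in> Words n"
      by (auto simp: Words_def word_of_perm_def simp del: upt_Suc)
  qed
  show "card (word_of_perm ` ({n} \<times> {\<sigma>. \<sigma> permutes {1..n}})) = card (Words n)"
    using card_image[OF word_of_perm_inj] card_permutations[of "{1..n}" n] card_Words
    by (simp add: card_cartesian_product)
qed (simp add: card_Words)

text \<open>All values in the first block are smaller than those in the second and stand before them,
  so there are no inversions between the blocks.\<close>

lemma word_of_perm_interlace:
  assumes \<rho>: "\<rho> permutes {1..m}" and \<sigma>: "\<sigma> permutes {1..n}"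
    and \<theta>: "interlace (m, \<rho>) (n, \<sigma>) = (k, \<theta>)" and perm: "\<theta> permutes {1..k}"
  shows "word_of_perm (k, \<theta>) = word_of_perm (m, \<rho>) @ word_of_perm (n, \<sigma>)"
proof -
  have k: "k = m + n" using \<theta> by (simp add: interlace_def)
  have lo: "\<theta> i = \<rho> i" if "i \<in> {1..m}" for i
    using \<theta> that by (auto simp: interlace_def)
  have hi: "\<theta> (i + m) = \<sigma> i + m" if "i \<in> {1..n}" for i
    using \<theta> that by (auto simp: interlace_def)
  have \<rho>': "place \<rho> i \<in> {1..m}" if "i \<in> {1..m}" for i
    using permutes_in_image[OF permutes_inv[OF \<rho>]] that by blast
  have \<sigma>': "place \<sigma> i \<in> {1..n}" if "i \<in> {1..n}" for i
    using permutes_in_image[OF permutes_inv[OF \<sigma>]] that by blast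
  have inv_lo: "place \<theta> i = place \<rho> i" if "i \<in> {1..m}" for i
    using lo[OF \<rho>'[OF that]] permutes_inv_eq[OF perm] permutes_inverses[OF \<rho>] by metis
  have inv_hi: "place \<theta> (i + m) = place \<sigma> i + m" if "i \<in> {1..n}" for i
    using hi[OF \<sigma>'[OF that]] permutes_inv_eq[OF perm] permutes_inverses[OF \<sigma>] by metis
  have cnt_lo: "inv_count \<theta> i = inv_count \<rho> i" if i: "i \<in> {1..m}" for i
  proof -
    have "{j. 1 \<le> j \<and> j < place \<theta> i \<and> \<theta> j > i} = {j. 1 \<le> j \<and> j < place \<rho> i \<and> \<rho> j > i}"
      using lo inv_lo[OF i] \<rho>'[OF i] by auto
    then show ?thesis by (simp add: inv_count_def)
  qed
  have cnt_hi: "inv_count \<theta> (i + m) = inv_count \<sigma> i" if i: "i \<in> {1..n}" for i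
  proof -
    have "{a \<in> {i + m<..k}. place \<theta> a < place \<theta> (i + m)} =
        (\<lambda>a. a + m) ` {a \<in> {i<..n}. place \<sigma> a < place \<sigma> i}"
    proof (intro subset_antisym subsetI)
      fix c assume c: "c \<in> {a \<in> {i + m<..k}. place \<theta> a < place \<theta> (i + m)}"
      define a where "a = c - m"
      have ca: "c = a + m" and a: "a \<in> {i<..n}" using c k by (auto simp: a_def)
      then have "place \<sigma> a < place \<sigma> i" using c i inv_hi[of a] inv_hi[of i] by auto
      with ca a show "c \<in> (\<lambda>a. a + m) ` {a \<in> {i<..n}. place \<sigma> a < place \<sigma> i}" by blast
    next
      fix c assume "c \<in> (\<lambda>a. a + m) ` {a \<in> {i<..n}. place \<sigma> a < place \<sigma> i}"
      then show "c \<in> {a \<in> {i + m<..k}. place \<theta> a < place \<theta> (i + m)}"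
        using i inv_hi k by auto
    qed
    then have "card {a \<in> {i + m<..k}. place \<theta> a < place \<theta> (i + m)} =
        card {a \<in> {i<..n}. place \<sigma> a < place \<sigma> i}"
      by (simp add: card_image)
    then show ?thesis
      using inv_count_eq[OF perm, of "i + m"] inv_count_eq[OF \<sigma> i] i k by simp
  qed
  have "[1..<Suc k] = [1..<Suc m] @ map (\<lambda>i. i + m) [1..<Suc n]"
    using upt_add_eq_append[of 1 "Suc m" n] by (simp add: k map_add_const_upt ac_simps del: upt_Suc)
  then show ?thesis
    using cnt_lo cnt_hi by (auto simp: word_of_perm_def simp del: upt_Suc)
qed

text \<open>Inherited from the trees.\<close>

lemma S_monoid_closed:
  assumes "a \<in> carrier S_monoid" "b \<in> carrier S_monoid"
  shows "a \<otimes>\<^bsub>S_monoid\<^esub> b \<in> carrier S_monoid"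
proof -
  have im: "perm_of_tree ` carrier T_monoid = carrier S_monoid" 
    and hom: "perm_of_tree \<in> hom T_monoid S_monoid"
    using perm_of_tree_iso by (auto simp: iso_def bij_betw_def)
  obtain r s where rs: "a = perm_of_tree r" "b = perm_of_tree s" 
      "r \<in> carrier T_monoid" "s \<in> carrier T_monoid"
    using assms unfolding im[symmetric] by blast
  then have "a \<otimes>\<^bsub>S_monoid\<^esub> b = perm_of_tree (r \<otimes>\<^bsub>T_monoid\<^esub> s)"
    using hom_mult[OF hom] by simp
  then show ?thesis using T_monoid_closed rs im by blast
qed

lemma word_of_perm_iso: "word_of_perm \<in> iso S_monoid X_monoid"
proof -
  have S: "carrier S_monoid = (\<Union>n. {n} \<times> {\<sigma>. \<sigma> permutes {1..n}})"
    by (auto simp: S_monoid_def)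
  have "word_of_perm ` carrier S_monoid = carrier X_monoid"
    unfolding S image_UN image_word_of_perm by (simp add: X_monoid_def)
  moreover have "inj_on word_of_perm (carrier S_monoid)"
  proof (rule inj_onI)
    fix x y assume xy: "x \<in> carrier S_monoid" "y \<in> carrier S_monoid"
      and eq: "word_of_perm x = word_of_perm y"
    have len: "length (word_of_perm z) = fst z" for z
      by (simp add: word_of_perm_def case_prod_beta)
    have "fst x = fst y" using arg_cong[OF eq, of length] by (simp only: len)
    then have "x \<in> {fst x} \<times> {\<sigma>. \<sigma> permutes {1..fst x}}" "y \<in> {fst x} \<times> {\<sigma>. \<sigma> permutes {1..fst x}}"
      using xy unfolding S by auto
    with eq show "x = y" using word_of_perm_inj by (meson inj_onD)
  qed
  moreover have "word_of_perm (x \<otimes>\<^bsub>S_monoid\<^esub> y) = word_of_perm x @ word_of_perm y"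
    if xy: "x \<in> carrier S_monoid" "y \<in> carrier S_monoid" for x y
  proof -
    obtain m \<rho> n \<sigma> k \<theta> where *: "x = (m, \<rho>)" "y = (n, \<sigma>)" "interlace x y = (k, \<theta>)"
      by (metis surj_pair)
    then show ?thesis
      using word_of_perm_interlace S_monoid_closed[OF xy] xy by (simp add: S_monoid_def)
  qed
  ultimately show ?thesis
    by (auto simp: iso_def hom_def bij_betw_def X_monoid_def)
qed

section \<open>Freeness\<close>

text \<open>Trees without any labels.  Leaf labels have to be forgotten too, since stacking shifts those in
  the subtrees to the right of the spine.\<close>

datatype shape = Tip | Fork shape shape

fun shape_of :: "'a lbtree \<Rightarrow> shape" where
  "shape_of (Leaf i) = Tip"
| "shape_of (Node l a r) = Fork (shape_of l) (shape_of r)"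

text \<open>The subtrees to the right of the left spine, from the bottom to the top.\<close>

fun branches :: "shape \<Rightarrow> shape list" where
  "branches Tip = []"
| "branches (Fork l r) = branches l @ [r]"

lemma bij_branches: "bij branches"
proof (rule bijI)
  show "inj branches"
  proof (rule injI)
    fix s t show "branches s = branches t \<Longrightarrow> s = t"
    proof (induction s arbitrary: t)
      case Tip
      then show ?case by (cases t) auto
    next
      case (Fork l r)
      then show ?case by (cases t) auto
    qed
  qed
  have "\<exists>s. branches s = rs" for rs
  proof (induction rs rule: rev_induct)
    case (snoc r rs)
    then obtain s where "branches s = rs" by blast
    then have "branches (Fork s r) = rs @ [r]" by simp
    then show ?case by blast
  qed (use branches.simps(1) in blast)
  then show "surj branches" by (metis surjI)
qed

lemma shape_of_graft_no_zero:
  "0 \<notin> set (leaves s) \<Longrightarrow> shape_of (graft m r s) = shape_of s"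
  by (induction s) auto

lemma branches_graft:
  assumes "hd (leaves s) = 0" "0 \<notin> set (tl (leaves s))"
  shows "branches (shape_of (graft m r s)) = branches (shape_of r) @ branches (shape_of s)"
  using assms
proof (induction s)
  case (Node l a t)
  have "leaves l \<noteq> []" using length_leaves[of l] by auto
  with Node show ?case by (simp add: shape_of_graft_no_zero)
qed simp

lemma shape_of_length_leaves:
  "shape_of s = shape_of t \<Longrightarrow> length (leaves s) = length (leaves t)"
proof (induction s arbitrary: t)
  case (Leaf i)
  then show ?case by (cases t) auto
next
  case (Node l a r)
  then show ?case by (cases t) auto
qed

text \<open>Equal shapes allow the common leaf list of two nodes to be split at the same place, which
  carries the equality of leaves down to the subtrees.\<close>

lemma unlabelled_eq_iff:
  "map_lbtree (\<lambda>_. ()) s = map_lbtree (\<lambda>_. ()) t \<longleftrightarrow>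
     shape_of s = shape_of t \<and> leaves s = leaves t"
proof (induction s arbitrary: t)
  case (Leaf i)
  then show ?case by (cases t) auto
next
  case (Node l a r)
  then show ?case
    by (cases t) (auto dest: shape_of_length_leaves)
qed

text \<open>Number the interior vertices in postorder.  The offsets \<open>m\<close> of the interior labels and \<open>k\<close>
  of the leaf labels are arbitrary because the right subtree continues the numbering of the left one.\<close>

lemma shape_has_decreasing_labelling:
  "\<exists>t. shape_of t = s \<and> decreasing t \<and> distinct (interior t) \<and>
     set (interior t) = {m<..m + length (interior t)} \<and>
     leaves t = [k..<Suc (k + length (interior t))]"
proof (induction s arbitrary: m k)
  case Tip
  show ?case by (rule exI[of _ "Leaf k"]) simp
next
  case (Fork s1 s2)
  obtain l where l: "shape_of l = s1" "decreasing l" "distinct (interior l)"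
    "set (interior l) = {m<..m + length (interior l)}"
    "leaves l = [k..<Suc (k + length (interior l))]"
    using Fork.IH(1) by blast
  let ?m = "m + length (interior l)" and ?k = "Suc (k + length (interior l))"
  obtain r where r: "shape_of r = s2" "decreasing r" "distinct (interior r)"
    "set (interior r) = {?m<..?m + length (interior r)}"
    "leaves r = [?k..<Suc (?k + length (interior r))]"
    using Fork.IH(2) by blast
  let ?t = "Node l (Suc (?m + length (interior r))) r"
  have "leaves ?t = [k..<Suc (k + length (interior ?t))]"
    using upt_add_eq_append[of k ?k "Suc (length (interior r))"]
    by (simp add: l(5) r(5) ac_simps del: upt_Suc)
  moreover have "set (interior ?t) = {m<..m + length (interior ?t)}"
    using l(4) r(4) by auto
  moreover have "distinct (interior ?t)"
    using l(3,4) r(3,4) by auto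
  moreover have "decreasing ?t"
    using l(2,4) r(2,4) by auto
  ultimately show ?case
    using l(1) r(1) by (intro exI[of _ ?t]) simp
qed

definition tree_word :: "nat lbtree \<Rightarrow> shape list" where
  "tree_word t = branches (shape_of t)"

lemma tree_word_hom: "tree_word \<in> hom T_monoid (free_monoid UNIV)"
proof (rule homI)
  fix r s assume "s \<in> carrier T_monoid"
  then obtain n where "s \<in> Trees n" by (auto simp: T_monoid_def)
  then show "tree_word (r \<otimes>\<^bsub>T_monoid\<^esub> s) = tree_word r \<otimes>\<^bsub>free_monoid UNIV\<^esub> tree_word s"
    using TreesD(1)
    by (simp add: T_monoid_def free_monoid_def tree_word_def stack_def branches_graft upt_conv_Cons
        del: upt_Suc)
qed (simp add: free_monoid_def)

lemma tree_word_surj: "tree_word ` carrier T_monoid = carrier (free_monoid UNIV)"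
proof -
  have "\<exists>t \<in> carrier T_monoid. tree_word t = w" for w
  proof -
    obtain s where "branches s = w" using bij_branches by (metis bij_pointE)
    obtain t where t: "shape_of t = s" "decreasing t" "distinct (interior t)"
      "set (interior t) = {0<..0 + length (interior t)}"
      "leaves t = [0..<Suc (0 + length (interior t))]"
      using shape_has_decreasing_labelling by blast
    have "{0<..length (interior t)} = {1..length (interior t)}" by auto
    then have "t \<in> Trees (length (interior t))"
      using t(2-5) by (simp add: Trees_def del: upt_Suc)
    with \<open>branches s = w\<close> t(1) show ?thesis by (auto simp: T_monoid_def tree_word_def)
  qed
  then have "UNIV \<subseteq> tree_word ` carrier T_monoid" by (metis image_eqI subsetI)
  then show ?thesis by (auto simp: free_monoid_def)
qed

lemma T_sim_kernel:
  "T_sim = {(r, t). r \<in> carrier T_monoid \<and> t \<in> carrier T_monoid \<and> tree_word r = tree_word t}"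
proof -
  have "map_lbtree (\<lambda>_. ()) r = map_lbtree (\<lambda>_. ()) t \<longleftrightarrow> tree_word r = tree_word t"
    if "r \<in> carrier T_monoid" "t \<in> carrier T_monoid" for r t
  proof -
    have "leaves r = leaves t" if "shape_of r = shape_of t"
      using shape_of_length_leaves[OF that] \<open>r \<in> _\<close> \<open>t \<in> _\<close>
      by (auto simp: T_monoid_def TreesD(1) simp del: upt_Suc)
    then show ?thesis
      unfolding unlabelled_eq_iff tree_word_def using bij_branches by (auto simp: bij_def inj_eq)
  qed
  then show ?thesis by (auto simp: T_sim_def)
qed

theorem proposition2:
  shows "image perm_of_tree \<in> iso (quot_monoid T_monoid T_sim) (quot_monoid S_monoid S_sim) \<and>
         image word_of_perm \<in> iso (quot_monoid S_monoid S_sim) (quot_monoid X_monoid X_sim) \<and>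
         is_free_monoid (quot_monoid T_monoid T_sim) \<and>
         is_free_monoid (quot_monoid S_monoid S_sim) \<and>
         is_free_monoid (quot_monoid X_monoid X_sim)"
proof -
  let ?QT = "quot_monoid T_monoid T_sim" and ?QS = "quot_monoid S_monoid S_sim"
    and ?QX = "quot_monoid X_monoid X_sim" and ?F = "free_monoid (UNIV :: shape set)"
  have T: "T_sim \<subseteq> carrier T_monoid \<times> carrier T_monoid"
    by (auto simp: T_sim_def)
  have pt: "perm_of_tree ` carrier T_monoid = carrier S_monoid"
    using perm_of_tree_iso by (simp add: iso_def bij_betw_def)
  have S: "S_sim \<subseteq> carrier S_monoid \<times> carrier S_monoid"
    unfolding S_sim_def pt[symmetric] using T by auto
  have X: "X_sim = map_prod word_of_perm word_of_perm ` S_sim"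
    by (simp add: X_sim_def S_sim_def image_image map_prod.comp prod.map_comp)
  have p: "image perm_of_tree \<in> iso ?QT ?QS"
    unfolding S_sim_def
    by (rule image_quot_monoid_iso[OF perm_of_tree_iso T_monoid_closed T])
  have w: "image word_of_perm \<in> iso ?QS ?QX"
    unfolding X by (rule image_quot_monoid_iso[OF word_of_perm_iso S_monoid_closed S])
  define \<phi> where "\<phi> y = {t \<in> carrier T_monoid. tree_word t = y}" for y
  have \<phi>: "\<phi> \<in> iso ?F ?QT"
    unfolding \<phi>_def
    by (rule fibre_quot_monoid_iso[OF T_monoid_closed tree_word_hom tree_word_surj T_sim_kernel])
  have "Leaf 0 \<in> Trees 0" by (simp add: Trees_def)
  then have L: "Leaf 0 \<in> carrier T_monoid" by (auto simp: T_monoid_def)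
  then have oneT: "\<phi> [] = \<one>\<^bsub>?QT\<^esub>"
    by (auto simp: \<phi>_def quot_monoid_def T_sim_kernel T_monoid_def tree_word_def)
  have oneS: "perm_of_tree ` \<one>\<^bsub>?QT\<^esub> = \<one>\<^bsub>?QS\<^esub>"
  proof -
    have "perm_of_tree (Leaf 0) = (0, id)" by (auto simp: perm_of_tree_def)
    moreover have "inj_on perm_of_tree (carrier T_monoid)"
      using perm_of_tree_iso by (simp add: iso_def bij_betw_def)
    ultimately show ?thesis
      using image_quot_class[OF _ T L, of perm_of_tree]
      by (simp add: quot_monoid_def S_sim_def T_monoid_def S_monoid_def)
  qed
  have oneX: "word_of_perm ` \<one>\<^bsub>?QS\<^esub> = \<one>\<^bsub>?QX\<^esub>"
    using image_quot_class[OF _ S, of word_of_perm "(0, id)"] word_of_perm_iso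
    by (simp add: quot_monoid_def iso_def bij_betw_def X S_monoid_def X_monoid_def
        word_of_perm_def permutes_id)
  have "is_free_monoid ?QT"
    using \<phi> oneT by (rule is_free_monoidI)
  moreover have "is_free_monoid ?QS"
    using iso_set_trans[OF \<phi> p] by (rule is_free_monoidI) (simp add: compose_def free_monoid_def oneT oneS)
  moreover have "is_free_monoid ?QX"
    using iso_set_trans[OF iso_set_trans[OF \<phi> p] w]
    by (rule is_free_monoidI) (simp add: compose_def free_monoid_def oneT oneS oneX)
  ultimately show ?thesis using p w by blast
qed

end
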